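(* Let $B$ be a two-state max-plus automaton over a finite alphabet $\Sigma$, and let $K$ be the constant associated with $B$ in the context. Consider the projective states with finite signed gap $z\in\mathbb{Z}$ and gap magnitude $n=|z|>K$; the tail side is the sign of $z$. Then for every letter $\sigma\in\Sigma$ and each tail side for which the transition by $\sigma$ is nondead, the transition has exactly one of the following forms, valid for all $n>K$ on that side, with constants determined by the letter and the tail side: (i) propagate: the successor has a finite gap whose magnitude is $n'=n+s$ for a fixed integer $s$, with a fixed successor side (sign of the successor gap), while the height increment is a fixed constant $c\in\mathbb{Z}$; (ii) forget: the successor projective state is independent of $n$, while the height increment is a fixed constant $c\in\mathbb{Z}$; (iii) read-and-forget: the successor projective state is independent of $n$, while the height increment is $c-n$ for a fixed constant $c\in\mathbb{Z}$. Here propagate refers to preservation of the dependence on $n$: the shifted value $n'=n+s$ may be at most $K$ for a particular input. In particular, whenever the height increment depends on the unbounded gap magnitude $n$, that magnitude is not propagated to the successor (the successor projective state is independent of $n$).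
   Context: $\mathbb{Z}_{\max}=(\mathbb{Z}\cup\{-\infty\},\max,+)$ is the max-plus semiring, with $-\infty$ absorbing for $+$. A two-state max-plus automaton $B$ over a finite alphabet $\Sigma$ consists of an initial row vector in $\mathbb{Z}_{\max}^{1\times 2}$, a matrix $M_\sigma\in\mathbb{Z}_{\max}^{2\times2}$ for each $\sigma\in\Sigma$, and a final column vector in $\mathbb{Z}_{\max}^{2\times1}$. Constant $K$: let $E\subset\mathbb{Z}$ be the set of all finite (i.e. $\ne-\infty$) transition, initial and final weights of $B$. Put $K=1+\max\{|\alpha-\beta|:\alpha,\beta\in E\}$, with $K=1$ if $E$ has fewer than two elements. Projective states: for a row vector $x=(x_1,x_2)\in\mathbb{Z}_{\max}^2$ with $x\ne(-\infty,-\infty)$, its height is $H(x)=\max(x_1,x_2)$. Its projective state is its class modulo adding a common integer to both coordinates, and is recorded by its signed gap: $z(x)=x_1-x_2\in\mathbb{Z}$ if both coordinates are finite; $+\infty$ if only $x_1$ is finite; $-\infty$ if only $x_2$ is finite. The gap magnitude of a finite gap is $|z(x)|$. Transitions: the letter $\sigma$ maps $x$ to $xM_\sigma$ (max-plus product). The transition is dead if $xM_\sigma=(-\infty,-\infty)$ and nondead otherwise. For a nondead transition, the successor projective state is that of $xM_\sigma$ and the height increment is $H(xM_\sigma)-H(x)\in\mathbb{Z}$; both depend only on $\sigma$ and the projective state of $x$. *)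

theory Defs
  imports "HOL-Analysis.Analysis" "HOL-Library.Extended"
begin

section \<open>The max-plus semiring of integers\<close>

text \<open>Class \<open>plus\<close> carries the maximum and class \<open>times\<close> the addition of integers, so that
  \<open>0\<close> is minus infinity, \<open>1\<close> is the integer zero, and the library product \<open>v*\<close> of a
  row vector with a matrix is the max-plus product. The selector \<open>the_int\<close> is unspecified
  at minus infinity.\<close>

datatype zmax = NegInf | Fint (the_int: int)

instantiation zmax :: linorder
begin

fun less_eq_zmax :: "zmax \<Rightarrow> zmax \<Rightarrow> bool" where
  "NegInf \<le> _ = True"
| "Fint _ \<le> NegInf = False"
| "Fint a \<le> Fint b = (a \<le> b)"

definition less_zmax :: "zmax \<Rightarrow> zmax \<Rightarrow> bool" where
  "less_zmax a b \<longleftrightarrow> a \<le> b \<and> \<not> b \<le> a"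

instance
proof
  fix a b c :: zmax
  show "(a < b) = (a \<le> b \<and> \<not> b \<le> a)" by (rule less_zmax_def)
  show "a \<le> a" by (cases a) auto
  show "a \<le> b \<Longrightarrow> b \<le> c \<Longrightarrow> a \<le> c" by (cases a; cases b; cases c) auto
  show "a \<le> b \<Longrightarrow> b \<le> a \<Longrightarrow> a = b" by (cases a; cases b) auto
  show "a \<le> b \<or> b \<le> a" by (cases a; cases b) auto
qed

end

instantiation zmax :: comm_semiring_1
begin

definition zero_zmax :: zmax where "zero_zmax = NegInf"

definition one_zmax :: zmax where "one_zmax = Fint 0"

definition plus_zmax :: "zmax \<Rightarrow> zmax \<Rightarrow> zmax" where "plus_zmax a b = max a b"

fun times_zmax :: "zmax \<Rightarrow> zmax \<Rightarrow> zmax" where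
  "times_zmax (Fint a) (Fint b) = Fint (a + b)"
| "times_zmax NegInf _ = NegInf"
| "times_zmax _ NegInf = NegInf"

instance
proof
  fix a b c :: zmax
  show "a * b * c = a * (b * c)" by (cases a; cases b; cases c) auto
  show "a * b = b * a" by (cases a; cases b) auto
  show "1 * a = a" by (cases a) (auto simp: one_zmax_def)
  show "a + b + c = a + (b + c)" by (simp add: plus_zmax_def max.assoc)
  show "a + b = b + a" by (simp add: plus_zmax_def max.commute)
  show "0 + a = a" by (cases a) (auto simp: plus_zmax_def zero_zmax_def max_def)
  show "0 * a = 0" "a * 0 = 0" by (cases a; simp add: zero_zmax_def)+
  show "(a + b) * c = a * c + b * c"
    by (cases a; cases b; cases c) (auto simp: plus_zmax_def max_def)
  show "(0::zmax) \<noteq> 1" by (simp add: zero_zmax_def one_zmax_def)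
qed

end

section \<open>Two-state automata and their projective states\<close>

record 's automaton =
  init_vec :: "zmax^2"
  trans_mat :: "'s \<Rightarrow> zmax^2^2"
  final_vec :: "zmax^2"

definition finite_weights :: "'s automaton \<Rightarrow> int set" where
  "finite_weights B = {w. (\<exists>i. init_vec B $ i = Fint w) \<or>
     (\<exists>\<sigma> i j. trans_mat B \<sigma> $ i $ j = Fint w) \<or> (\<exists>i. final_vec B $ i = Fint w)}"

definition const_K :: "'s automaton \<Rightarrow> int" where
  "const_K B = (if card (finite_weights B) < 2 then 1
     else 1 + Max {\<bar>\<alpha> - \<beta>\<bar> | \<alpha> \<beta>. \<alpha> \<in> finite_weights B \<and> \<beta> \<in> finite_weights B})"

text \<open>\<open>height\<close> and \<open>signed_gap\<close> are meaningful only for vectors other than \<open>0\<close>, the vector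
  with both coordinates minus infinity.\<close>

definition height :: "zmax^2 \<Rightarrow> int" where
  "height x = the_int (max (x $ 1) (x $ 2))"

definition signed_gap :: "zmax^2 \<Rightarrow> int extended" where
  "signed_gap x = (case (x $ 1, x $ 2) of
      (Fint a, Fint b) \<Rightarrow> Fin (a - b)
    | (Fint a, NegInf) \<Rightarrow> Pinf
    | (NegInf, Fint b) \<Rightarrow> Minf
    | (NegInf, NegInf) \<Rightarrow> undefined)"

text \<open>The signed gap is a complete invariant of the class of a vector modulo adding a common
  integer to both coordinates.\<close>

lemma signed_gap_eq_iff:
  assumes "x \<noteq> 0" "y \<noteq> 0"
  shows "signed_gap x = signed_gap y \<longleftrightarrow> (\<exists>k. \<forall>i. y $ i = x $ i * Fint k)"
proof -
  have x: "x $ 1 \<noteq> NegInf \<or> x $ 2 \<noteq> NegInf" and y: "y $ 1 \<noteq> NegInf \<or> y $ 2 \<noteq> NegInf"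
    using assms by (auto simp: vec_eq_iff forall_2 zero_zmax_def)
  have ex: "\<exists>k. (b::int) = a + k" for a b by (rule exI[of _ "b - a"]) simp
  have ex2: "a - b = c - d \<longleftrightarrow> (\<exists>k. c = a + k \<and> d = b + k)" for a b c d :: int
    by (auto intro: exI[of _ "c - a"])
  show ?thesis using x y
    by (cases "x $ 1"; cases "x $ 2"; cases "y $ 1"; cases "y $ 2")
       (simp_all add: signed_gap_def forall_2 ex ex2)
qed

section \<open>Transitions\<close>

definition succ_vec :: "'s automaton \<Rightarrow> 's \<Rightarrow> zmax^2 \<Rightarrow> zmax^2" where
  "succ_vec B \<sigma> x = x v* trans_mat B \<sigma>"

definition nondead :: "'s automaton \<Rightarrow> 's \<Rightarrow> zmax^2 \<Rightarrow> bool" where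
  "nondead B \<sigma> x \<longleftrightarrow> succ_vec B \<sigma> x \<noteq> 0"

definition height_incr :: "'s automaton \<Rightarrow> 's \<Rightarrow> zmax^2 \<Rightarrow> int" where
  "height_incr B \<sigma> x = height (succ_vec B \<sigma> x) - height x"

text \<open>A side is one of the signs \<open>1\<close> and \<open>-1\<close>. The set \<open>tail B side n\<close> consists of all
  representatives of the projective state on that side with gap magnitude \<open>n\<close>; it is empty
  unless \<open>n\<close> exceeds \<open>const_K B\<close>.\<close>

definition tail :: "'s automaton \<Rightarrow> int \<Rightarrow> int \<Rightarrow> (zmax^2) set" where
  "tail B side n = {x. x \<noteq> 0 \<and> n > const_K B \<and>
     (\<exists>z. signed_gap x = Fin z \<and> sgn z = side \<and> \<bar>z\<bar> = n)}"

text \<open>Each form includes that the transition is nondead on the entire side, since successor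
  state and height increment are undefined for dead transitions.\<close>

definition propagate :: "'s automaton \<Rightarrow> 's \<Rightarrow> int \<Rightarrow> bool" where
  "propagate B \<sigma> side \<longleftrightarrow> (\<exists>s c. \<exists>side' \<in> {1, -1}. \<forall>n. \<forall>x \<in> tail B side n. nondead B \<sigma> x \<and>
     (\<exists>z. signed_gap (succ_vec B \<sigma> x) = Fin z \<and> \<bar>z\<bar> = n + s \<and> sgn z = side') \<and>
     height_incr B \<sigma> x = c)"

definition forget :: "'s automaton \<Rightarrow> 's \<Rightarrow> int \<Rightarrow> bool" where
  "forget B \<sigma> side \<longleftrightarrow> (\<exists>q c. \<forall>n. \<forall>x \<in> tail B side n. nondead B \<sigma> x \<and>
     signed_gap (succ_vec B \<sigma> x) = q \<and> height_incr B \<sigma> x = c)"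

definition read_and_forget :: "'s automaton \<Rightarrow> 's \<Rightarrow> int \<Rightarrow> bool" where
  "read_and_forget B \<sigma> side \<longleftrightarrow> (\<exists>q c. \<forall>n. \<forall>x \<in> tail B side n. nondead B \<sigma> x \<and>
     signed_gap (succ_vec B \<sigma> x) = q \<and> height_incr B \<sigma> x = c - n)"

text \<open>It suffices that the transition is nondead at one state of the side.\<close>

definition nondead_side :: "'s automaton \<Rightarrow> 's \<Rightarrow> int \<Rightarrow> bool" where
  "nondead_side B \<sigma> side \<longleftrightarrow> (\<exists>n. \<exists>x \<in> tail B side n. nondead B \<sigma> x)"

end

theory Submission
  imports Defs
begin

text \<open>On a tail side one coordinate of the vector exceeds the other by \<open>n > K\<close>. Two weights differ by
  less than \<open>K\<close>, so in each column of the letter matrix the entry in the row of the larger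
  coordinate, if finite, decides the maximum. If this row is finite in both columns, the smaller
  coordinate is forgotten. If it is finite in one column, the other column is either minus
  infinity (forget) or carries the smaller coordinate (propagate). If it is minus infinity in both
  columns, the successor is a translate of the other row by the smaller coordinate, which lies \<open>n\<close>
  below the height (read and forget).\<close>

text \<open>\<open>Fint\<close> embeds the weights injectively into the entries of \<open>B\<close>,
  of which a finite alphabet leaves only finitely many. This gives the \<open>Max\<close> in
  \<open>const_K\<close> its meaning.\<close>

lemma finite_finite_weights:
  fixes B :: "('s::finite) automaton"
  shows "finite (finite_weights B)"
proof -
  have "Fint ` finite_weights B \<subseteq> range (($) (init_vec B)) \<union> range (($) (final_vec B)) \<union>
      (\<Union>\<sigma> i. range (($) (trans_mat B \<sigma> $ i)))"
    unfolding finite_weights_def by (auto simp: image_iff) metis+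
  then have "finite (Fint ` finite_weights B)"
    by (rule finite_subset) simp
  then show ?thesis
    by (rule finite_imageD) (simp add: inj_on_def)
qed

text \<open>Strictness comes from the summand 1 in \<open>const_K\<close>; with fewer than two
  weights, \<alpha> and \<beta> coincide and the bound is 0 < 1.\<close>

lemma finite_weights_diff_less:
  fixes B :: "('s::finite) automaton"
  assumes "\<alpha> \<in> finite_weights B" "\<beta> \<in> finite_weights B"
  shows "\<bar>\<alpha> - \<beta>\<bar> < const_K B"
proof (cases "card (finite_weights B) < 2")
  case True
  then have "\<alpha> = \<beta>"
    using assms card_le_Suc0_iff_eq[OF finite_finite_weights[of B]] by auto
  then show ?thesis using True by (simp add: const_K_def)
next
  case False
  let ?D = "{\<bar>\<alpha> - \<beta>\<bar> | \<alpha> \<beta>. \<alpha> \<in> finite_weights B \<and> \<beta> \<in> finite_weights B}"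
  have "?D = (\<lambda>(\<alpha>, \<beta>). \<bar>\<alpha> - \<beta>\<bar>) ` (finite_weights B \<times> finite_weights B)"
    by auto
  then have "finite ?D"
    by (simp add: finite_finite_weights)
  moreover have "\<bar>\<alpha> - \<beta>\<bar> \<in> ?D"
    using assms by blast
  ultimately have "\<bar>\<alpha> - \<beta>\<bar> \<le> Max ?D"
    by (rule Max_ge)
  then show ?thesis using False by (simp add: const_K_def)
qed

lemma const_K_pos:
  fixes B :: "('s::finite) automaton"
  shows "const_K B > 0"
proof (cases "finite_weights B = {}")
  case False
  then obtain \<alpha> where "\<alpha> \<in> finite_weights B" by blast
  from finite_weights_diff_less[OF this this] show ?thesis by simp
qed (simp add: const_K_def)

lemma trans_mat_diff_less:
  fixes B :: "('s::finite) automaton"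
  assumes "trans_mat B \<sigma> $ i $ k = Fint u" "trans_mat B \<sigma> $ j $ l = Fint v"
  shows "\<bar>u - v\<bar> < const_K B"
  using assms by (intro finite_weights_diff_less) (auto simp: finite_weights_def)

text \<open>A positive gap makes coordinate 1 the larger one. Indexing by \<open>lead\<close> and
  \<open>lag\<close> treats both tail sides in one argument.\<close>

definition lead :: "int \<Rightarrow> 2" where
  "lead side = (if side = 1 then 1 else 2)"

definition lag :: "int \<Rightarrow> 2" where
  "lag side = (if side = 1 then 2 else 1)"

lemma tailE:
  fixes B :: "('s::finite) automaton"
  assumes "x \<in> tail B side n" "side \<in> {1, -1}"
  obtains p where "x $ lead side = Fint p" "x $ lag side = Fint (p - n)"
    "height x = p" "n > const_K B"
proof -
  from assms(1) obtain z where z: "signed_gap x = Fin z" "sgn z = side" "\<bar>z\<bar> = n"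
    and n: "n > const_K B" and "x \<noteq> 0" by (auto simp: tail_def)
  then have "x $ 1 \<noteq> NegInf \<or> x $ 2 \<noteq> NegInf"
    by (auto simp: vec_eq_iff forall_2 zero_zmax_def)
  with z obtain a b where ab: "x $ 1 = Fint a" "x $ 2 = Fint b" "z = a - b"
    by (auto simp: signed_gap_def split: zmax.splits)
  show thesis
  proof (cases "side = 1")
    case True
    with z ab have "b = a - n" "a > b" by (auto simp: sgn_if split: if_splits)
    with True ab n show thesis
      by (intro that[of a]) (auto simp: lead_def lag_def height_def max_def)
  next
    case False
    with z ab assms(2) have "a = b - n" "a < b" by (auto simp: sgn_if split: if_splits)
    with False ab n show thesis
      by (intro that[of b]) (auto simp: lead_def lag_def height_def max_def)
  qed
qed

text \<open>The three forms quantify universally over the tail, so telling them apart requires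
  actual states of prescribed magnitude.\<close>

lemma tail_nonempty:
  fixes B :: "('s::finite) automaton"
  assumes "side \<in> {1, -1}" "n > const_K B"
  shows "\<exists>x. x \<in> tail B side n"
proof
  let ?x = "vector [Fint (side * n), Fint 0] :: zmax^2"
  have "?x \<noteq> 0" by (auto simp: vec_eq_iff forall_2 zero_zmax_def)
  then show "?x \<in> tail B side n"
    using assms const_K_pos[of B]
    by (auto simp: tail_def signed_gap_def sgn_if abs_mult)
qed

lemma succ_vec_nth:
  assumes "side \<in> {1, -1}"
  shows "succ_vec B \<sigma> x $ k =
    max (x $ lead side * trans_mat B \<sigma> $ lead side $ k) (x $ lag side * trans_mat B \<sigma> $ lag side $ k)"
  using assms
  by (auto simp: succ_vec_def vector_matrix_mult_def sum_2 plus_zmax_def lead_def lag_def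
      mult.commute max.commute)

lemma succ_vec_tail_nth:
  fixes B :: "('s::finite) automaton"
  assumes "side \<in> {1, -1}" "n > const_K B"
    and x: "x $ lead side = Fint p" "x $ lag side = Fint (p - n)"
  shows "succ_vec B \<sigma> x $ k = (case trans_mat B \<sigma> $ lead side $ k of
      Fint u \<Rightarrow> Fint (p + u) | NegInf \<Rightarrow> Fint (p - n) * trans_mat B \<sigma> $ lag side $ k)"
proof (cases "trans_mat B \<sigma> $ lead side $ k")
  case NegInf
  then show ?thesis
    using x by (simp add: succ_vec_nth[OF assms(1)] max_def)
next
  case (Fint u)
  show ?thesis
  proof (cases "trans_mat B \<sigma> $ lag side $ k")
    case NegInf
    with Fint show ?thesis
      using x by (simp add: succ_vec_nth[OF assms(1)] max_def)
  next
    case v: (Fint v)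
    \<comment> \<open>The candidates are p + u and p - n + v; since v - u < K < n, the leading one
      wins strictly.\<close>
    from trans_mat_diff_less[OF Fint v] assms(2) have "v - n < u" by linarith
    with Fint v show ?thesis
      using x by (simp add: succ_vec_nth[OF assms(1)] max_def)
  qed
qed

lemma tail_transition:
  fixes B :: "('s::finite) automaton"
  assumes side: "side \<in> {1, -1}" and "nondead_side B \<sigma> side"
  shows "propagate B \<sigma> side \<or> forget B \<sigma> side \<or> read_and_forget B \<sigma> side"
proof -
  define R where "R = trans_mat B \<sigma> $ lead side"
  define S where "S = trans_mat B \<sigma> $ lag side"
  \<comment> \<open>This rule replaces a tail state by its height p and its magnitude n. The cases
    below then compute with the two fixed rows \<open>R\<close> and \<open>S\<close> only.\<close>
  have elim: thesis
    if "x \<in> tail B side n"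
      "\<And>p. height x = p \<Longrightarrow> n > const_K B \<Longrightarrow>
        (\<And>k. succ_vec B \<sigma> x $ k =
          (case R $ k of Fint u \<Rightarrow> Fint (p + u) | NegInf \<Rightarrow> Fint (p - n) * S $ k)) \<Longrightarrow> thesis"
    for x n thesis
    using that(1) side
  proof (rule tailE)
    fix p assume p: "x $ lead side = Fint p" "x $ lag side = Fint (p - n)"
      and h: "height x = p" "n > const_K B"
    show thesis
      using h succ_vec_tail_nth[OF side h(2) p, of \<sigma>, folded R_def S_def] by (rule that(2))
  qed
  have diff: "\<bar>u - v\<bar> < const_K B" if "R $ k = Fint u" "S $ l = Fint v" for u v k l
    using that trans_mat_diff_less unfolding R_def S_def by blast
  have vec0: "y = 0 \<longleftrightarrow> y $ 1 = NegInf \<and> y $ 2 = NegInf" for y :: "zmax^2"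
    by (simp add: vec_eq_iff forall_2 zero_zmax_def)
  note defs = nondead_def vec0 signed_gap_def height_incr_def height_def[of "succ_vec B \<sigma> _"] max_def
  consider (both) u v where "R $ 1 = Fint u" "R $ 2 = Fint v"
    | (first) u where "R $ 1 = Fint u" "R $ 2 = NegInf"
    | (second) v where "R $ 1 = NegInf" "R $ 2 = Fint v"
    | (none) "R $ 1 = NegInf" "R $ 2 = NegInf"
    by (metis zmax.exhaust)
  then show ?thesis
  proof cases
    case both
    then have "forget B \<sigma> side"
      unfolding forget_def
      \<comment> \<open>The successor is (p + u, p + v), in which n no longer occurs.\<close>
      by (intro exI[of _ "Fin (u - v)"] exI[of _ "max u v"] allI ballI)
        (erule elim, simp add: defs)
    then show ?thesis by blast
  next
    case first
    show ?thesis
    proof (cases "S $ 2")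
      case NegInf
      with first have "forget B \<sigma> side"
        unfolding forget_def
        by (intro exI[of _ Pinf] exI[of _ u] allI ballI) (erule elim, simp add: defs)
      then show ?thesis by blast
    next
      case (Fint d)
      with first diff[OF first(1) Fint] have "propagate B \<sigma> side"
        unfolding propagate_def
        \<comment> \<open>The successor is (p + u, p - n + d), with gap n + u - d. This is positive
          because d - u < K < n, so its height is p + u.\<close>
        by (intro exI[of _ "u - d"] exI[of _ u] bexI[of _ 1] allI ballI)
          (erule elim, auto simp: defs)
      then show ?thesis by blast
    qed
  next
    case second
    show ?thesis
    proof (cases "S $ 1")
      case NegInf
      with second have "forget B \<sigma> side"
        unfolding forget_def
        by (intro exI[of _ Minf] exI[of _ v] allI ballI) (erule elim, simp add: defs)
      then show ?thesis by blast
    next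
      case (Fint d)
      with second diff[OF second(2) Fint] have "propagate B \<sigma> side"
        unfolding propagate_def
        \<comment> \<open>Mirror image: the gap of (p - n + d, p + v) is -(n + v - d) < 0.\<close>
        by (intro exI[of _ "v - d"] exI[of _ v] bexI[of _ "-1"] allI ballI)
          (erule elim, auto simp: defs)
      then show ?thesis by blast
    qed
  next
    case none
    \<comment> \<open>One nondead state suffices: \<open>S\<close> does not depend on the state, so
      a finite entry of it keeps the transition nondead on the whole side.\<close>
    have "S $ 1 \<noteq> NegInf \<or> S $ 2 \<noteq> NegInf"
    proof -
      from assms(2) obtain n x where "x \<in> tail B side n" "nondead B \<sigma> x"
        by (auto simp: nondead_side_def)
      then show ?thesis
        using none by (elim elim) (auto simp: nondead_def vec0)
    qed
    with none have "read_and_forget B \<sigma> side"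
      unfolding read_and_forget_def
      \<comment> \<open>The successor is \<open>S\<close> shifted by p - n, so it has the gap of
        \<open>S\<close> and height p - n + \<open>height S\<close>.\<close>
      by (intro exI[of _ "signed_gap S"] exI[of _ "height S"] allI ballI)
        (erule elim, cases "S $ 1"; cases "S $ 2"; auto simp: defs height_def)
    then show ?thesis by blast
  qed
qed

theorem lemma3p1:
  fixes B :: "('s::finite) automaton" and \<sigma> :: 's and side :: int
  assumes "side \<in> {1, -1}"
    and "nondead_side B \<sigma> side"
  shows "(propagate B \<sigma> side \<or> forget B \<sigma> side \<or> read_and_forget B \<sigma> side) \<and>
    \<not> (propagate B \<sigma> side \<and> forget B \<sigma> side) \<and>
    \<not> (propagate B \<sigma> side \<and> read_and_forget B \<sigma> side) \<and>
    \<not> (forget B \<sigma> side \<and> read_and_forget B \<sigma> side) \<and>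
    ((\<nexists>c. \<forall>n. \<forall>x \<in> tail B side n. height_incr B \<sigma> x = c) \<longrightarrow>
      (\<exists>q. \<forall>n. \<forall>x \<in> tail B side n. signed_gap (succ_vec B \<sigma> x) = q))"
proof -
  \<comment> \<open>Two states with different magnitudes separate the forms: only propagation
    changes the successor gap between them, and only read-and-forget changes the increment.\<close>
  obtain x where x: "x \<in> tail B side (const_K B + 1)"
    using tail_nonempty[OF assms(1) less_add_one] by blast
  obtain y where y: "y \<in> tail B side (const_K B + 2)"
    using tail_nonempty[OF assms(1), of B "const_K B + 2"] by auto
  have gap: "signed_gap (succ_vec B \<sigma> x) \<noteq> signed_gap (succ_vec B \<sigma> y) \<and>
      height_incr B \<sigma> x = height_incr B \<sigma> y" if propagate: "propagate B \<sigma> side"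
  proof -
    from propagate obtain s c side' where *: "\<forall>n. \<forall>x \<in> tail B side n. nondead B \<sigma> x \<and>
        (\<exists>z. signed_gap (succ_vec B \<sigma> x) = Fin z \<and> \<bar>z\<bar> = n + s \<and> sgn z = side') \<and>
        height_incr B \<sigma> x = c"
      unfolding propagate_def by (elim exE bexE)
    from *[rule_format, OF x] obtain z where "signed_gap (succ_vec B \<sigma> x) = Fin z"
      "\<bar>z\<bar> = const_K B + 1 + s" "height_incr B \<sigma> x = c" by (elim conjE exE)
    moreover from *[rule_format, OF y] obtain z' where "signed_gap (succ_vec B \<sigma> y) = Fin z'"
      "\<bar>z'\<bar> = const_K B + 2 + s" "height_incr B \<sigma> y = c" by (elim conjE exE)
    moreover from calculation have "z \<noteq> z'" by linarith
    ultimately show ?thesis by simp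
  qed
  have gap': "signed_gap (succ_vec B \<sigma> x) = signed_gap (succ_vec B \<sigma> y) \<and>
      height_incr B \<sigma> x = height_incr B \<sigma> y" if forget: "forget B \<sigma> side"
  proof -
    from forget obtain q c where *: "\<forall>n. \<forall>x \<in> tail B side n. nondead B \<sigma> x \<and>
        signed_gap (succ_vec B \<sigma> x) = q \<and> height_incr B \<sigma> x = c"
      unfolding forget_def by (elim exE)
    from *[rule_format, OF x] *[rule_format, OF y] show ?thesis by simp
  qed
  have incr: "height_incr B \<sigma> x \<noteq> height_incr B \<sigma> y" if read: "read_and_forget B \<sigma> side"
  proof -
    from read obtain q c where *: "\<forall>n. \<forall>x \<in> tail B side n. nondead B \<sigma> x \<and>
        signed_gap (succ_vec B \<sigma> x) = q \<and> height_incr B \<sigma> x = c - n"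
      unfolding read_and_forget_def by (elim exE)
    from *[rule_format, OF x] *[rule_format, OF y] show ?thesis by simp
  qed
  show ?thesis
  proof (intro conjI impI)
    show "propagate B \<sigma> side \<or> forget B \<sigma> side \<or> read_and_forget B \<sigma> side"
      by (rule tail_transition[OF assms])
    show "\<not> (propagate B \<sigma> side \<and> forget B \<sigma> side)"
      using gap gap' by metis
    show "\<not> (propagate B \<sigma> side \<and> read_and_forget B \<sigma> side)"
      using gap incr by metis
    show "\<not> (forget B \<sigma> side \<and> read_and_forget B \<sigma> side)"
      using gap' incr by metis
    \<comment> \<open>Dependence of the increment on n means that it is not constant on the side.
      This excludes propagation, and both remaining forms fix the successor gap.\<close>
    assume nonconst: "\<nexists>c. \<forall>n. \<forall>x \<in> tail B side n. height_incr B \<sigma> x = c"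
    have "\<not> propagate B \<sigma> side"
      using nonconst unfolding propagate_def by metis
    then consider "forget B \<sigma> side" | "read_and_forget B \<sigma> side"
      using tail_transition[OF assms] by argo
    then show "\<exists>q. \<forall>n. \<forall>x \<in> tail B side n. signed_gap (succ_vec B \<sigma> x) = q"
      unfolding forget_def read_and_forget_def by cases metis+
  qed
qed

end
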